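(* Let $\eta=\mathrm{diag}(1,-1,-1,-1)$. The set $V(\eta)$ of force tensors for $\eta$ is a real vector space with a basis given by the collections $$\boldsymbol\Theta^\beta_I\ \text{ with } I=0,1,2,3,01,02,03,12,13,23,\qquad i\,\boldsymbol\Theta^\beta_J\ \text{ with } J=\emptyset,012,013,023,123,0123,$$ where $\beta=0,1,2,3$. In particular, $V(\eta)$ has real dimension $64$.
   Context: Let $\mathbf e_0,\dots,\mathbf e_3$ be the standard basis of $\mathbb R^4$ with metric $\eta=\mathrm{diag}(1,-1,-1,-1)$, $\eta_{\alpha\beta}=\eta(\mathbf e_\alpha,\mathbf e_\beta)$. The complex exterior algebra $\bigwedge_*$ of $\mathbb R^4$ is a 16-dimensional complex vector space with basis $\mathbf e_I=\mathbf e_{\alpha_1}\wedge\cdots\wedge\mathbf e_{\alpha_k}$, $I=\alpha_1\cdots\alpha_k$ with $\alpha_1<\dots<\alpha_k$ (and $\mathbf e_\emptyset=1$), $|I|=k$; "$16\times16$ matrix" means a complex-linear operator on $\bigwedge_*$ in this basis, and $\dagger$ is the conjugate transpose in this basis. Gamma matrices: $\gamma_\alpha\psi=\mathbf e_\alpha\wedge\psi-\iota_\alpha\psi$, where $\iota_\alpha$ is the linear operator with $\iota_\alpha \mathbf e_\emptyset=0$, $\iota_\alpha\mathbf e_\beta=\eta_{\alpha\beta}\mathbf e_\emptyset$ and $\iota_\alpha(\mathbf e_I\wedge\mathbf e_J)=(\iota_\alpha\mathbf e_I)\wedge\mathbf e_J+(-1)^{|I|}\mathbf e_I\wedge\iota_\alpha\mathbf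 e_J$; $\gamma^\alpha=\eta^{\alpha\beta}\gamma_\beta$. Extended metric: $\hat\eta$ is the $16\times 16$ matrix with $\hat\eta_{IJ}=0$ if $|I|\ne|J|$ and $\hat\eta_{IJ}=\det(\eta_{\alpha_i\beta_j})$ if $I=\alpha_1\cdots\alpha_k$, $J=\beta_1\cdots\beta_k$. A force tensor (for $\eta$) is a collection $\boldsymbol\theta=\{\theta_0,\theta_1,\theta_2,\theta_3\}$ of four $16\times16$ complex matrices such that $\theta_\alpha^\dagger\hat\eta+\hat\eta\theta_\alpha=0$ and $[\gamma^\alpha,\theta_\beta]=0$ for all $\alpha,\beta$. $V(\eta)$ is the set of all force tensors, with componentwise addition and real scalar multiplication. $\Theta_I$ denotes the $16\times16$ matrix that commutes with all gamma matrices and satisfies $\Theta_I\mathbf e_\emptyset=\mathbf e_I$. $\boldsymbol\Theta^\beta_I$ denotes the collection with components $(\boldsymbol\Theta^\beta_I)_\alpha=\delta^\beta_\alpha\Theta_I$. *)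

theory Defs
  imports "Jordan_Normal_Form.Determinant" "HOL-Analysis.Analysis"
begin

(* Only the determinant of a matrix of varying size is taken from the carrier-based matrices;
   the symbol $ is kept for the Cartesian types of HOL-Analysis. *)
no_notation Matrix.vec_index (infixl \<open>$\<close> 100)
hide_const (open) Matrix.vec Matrix.mat Matrix.row Matrix.col Determinant.det

(* The index type 4 has the elements 0, 1, 2, 3 (4 = 0) in their usual order.
   A multi-index \<alpha>\<^sub>1 < ... < \<alpha>\<^sub>k is the set of its entries, so the 16 values of type "4 set"
   index the basis of the exterior algebra. *)
type_synonym ext = "complex ^ (4 set)"
type_synonym ext_mat = "complex ^ (4 set) ^ (4 set)"
type_synonym collection = "ext_mat ^ 4"

definition eta :: "real ^ 4 ^ 4" where
  "eta = (\<chi> \<alpha> \<beta>. if \<alpha> = \<beta> then (if \<alpha> = 0 then 1 else - 1) else 0)"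


definition e :: "4 set \<Rightarrow> ext" where
  "e I = axis I 1"

(* The sign sorts the concatenation of two increasing multi-indices. *)
definition wedge_sign :: "4 set \<Rightarrow> 4 set \<Rightarrow> complex" where
  "wedge_sign I J = (- 1) ^ card {(i, j). i \<in> I \<and> j \<in> J \<and> j < i}"

definition wedge :: "ext \<Rightarrow> ext \<Rightarrow> ext" (infixr \<open>\<and>\<^sub>*\<close> 75) where
  "u \<and>\<^sub>* v =
     (\<Sum>I\<in>UNIV. \<Sum>J\<in>UNIV.
        if I \<inter> J = {} then (u $ I * v $ J * wedge_sign I J) *s e (I \<union> J) else 0)"

lemma wedge_e: "e I \<and>\<^sub>* e J = (if I \<inter> J = {} then wedge_sign I J *s e (I \<union> J) else 0)"
proof -
  have "e I \<and>\<^sub>* e J = (\<Sum>A\<in>UNIV. \<Sum>B\<in>UNIV. if A = I then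
          (if B = J then (if I \<inter> J = {} then wedge_sign I J *s e (I \<union> J) else 0) else 0) else 0)"
    unfolding wedge_def by (intro sum.cong refl) (auto simp: e_def axis_def)
  also have "\<dots> = (if I \<inter> J = {} then wedge_sign I J *s e (I \<union> J) else 0)"
    by (subst sum.swap) (simp add: sum.delta)
  finally show ?thesis .
qed

lemma wedge_linear_left:
  "(a *s u + b *s v) \<and>\<^sub>* w = a *s (u \<and>\<^sub>* w) + b *s (v \<and>\<^sub>* w)"
  by (auto simp: wedge_def vec_eq_iff sum_distrib_left sum.distrib[symmetric] algebra_simps
      intro!: sum.cong)

lemma wedge_linear_right:
  "w \<and>\<^sub>* (a *s u + b *s v) = a *s (w \<and>\<^sub>* u) + b *s (w \<and>\<^sub>* v)"
  by (auto simp: wedge_def vec_eq_iff sum_distrib_left sum.distrib[symmetric] algebra_simps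
      intro!: sum.cong)

lemma wedge_sign_union_left:
  assumes "I \<inter> J = {}"
  shows "wedge_sign (I \<union> J) K = wedge_sign I K * wedge_sign J K"
proof -
  have "{(i, j). i \<in> I \<union> J \<and> j \<in> K \<and> j < i} =
      {(i, j). i \<in> I \<and> j \<in> K \<and> j < i} \<union> {(i, j). i \<in> J \<and> j \<in> K \<and> j < i}" by auto
  moreover have "{(i, j). i \<in> I \<and> j \<in> K \<and> j < i} \<inter> {(i, j). i \<in> J \<and> j \<in> K \<and> j < i} = {}"
    using assms by auto
  ultimately show ?thesis
    by (simp add: wedge_sign_def card_Un_disjoint power_add)
qed

lemma wedge_sign_union_right:
  assumes "J \<inter> K = {}"
  shows "wedge_sign I (J \<union> K) = wedge_sign I J * wedge_sign I K"
proof -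
  have "{(i, j). i \<in> I \<and> j \<in> J \<union> K \<and> j < i} =
      {(i, j). i \<in> I \<and> j \<in> J \<and> j < i} \<union> {(i, j). i \<in> I \<and> j \<in> K \<and> j < i}" by auto
  moreover have "{(i, j). i \<in> I \<and> j \<in> J \<and> j < i} \<inter> {(i, j). i \<in> I \<and> j \<in> K \<and> j < i} = {}"
    using assms by auto
  ultimately show ?thesis
    by (simp add: wedge_sign_def card_Un_disjoint power_add)
qed

lemma wedge_e_assoc: "(e I \<and>\<^sub>* e J) \<and>\<^sub>* e K = e I \<and>\<^sub>* (e J \<and>\<^sub>* e K)"
proof -
  have l: "(c *s u) \<and>\<^sub>* w = c *s (u \<and>\<^sub>* w)" for c u w
    using wedge_linear_left[of c u 0 u w] by simp
  have r: "w \<and>\<^sub>* (c *s u) = c *s (w \<and>\<^sub>* u)" for c u w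
    using wedge_linear_right[of w c u 0 u] by simp
  have zl: "0 \<and>\<^sub>* w = 0" and zr: "w \<and>\<^sub>* 0 = 0" for w
    by (simp_all add: wedge_def Finite_Cartesian_Product.zero_index cong: if_cong)
  show ?thesis
    by (auto simp: wedge_e l r zl zr wedge_sign_union_left wedge_sign_union_right Un_assoc
        Int_Un_distrib Int_Un_distrib2 vector_smult_assoc mult_ac)
qed

lemma wedge_unit: "e {} \<and>\<^sub>* e I = e I" "e I \<and>\<^sub>* e {} = e I"
  by (simp_all add: wedge_e wedge_sign_def)

lemma wedge_anticommute: "e {\<alpha>} \<and>\<^sub>* e {\<beta>} = - (e {\<beta>} \<and>\<^sub>* e {\<alpha>})"
proof -
  have *: "{(i, j). i = a \<and> j = b \<and> j < i} = (if b < a then {(a, b)} else {})" for a b :: 4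
    by auto
  show ?thesis
    by (cases \<alpha> \<beta> rule: linorder_cases)
       (auto simp: wedge_e wedge_sign_def * insert_commute not_less[symmetric])
qed

lemma e_insert:
  assumes "\<And>\<beta>. \<beta> \<in> I \<Longrightarrow> \<alpha> < \<beta>"
  shows "e (insert \<alpha> I) = e {\<alpha>} \<and>\<^sub>* e I"
proof -
  have *: "{(i, j). i \<in> {\<alpha>} \<and> j \<in> I \<and> j < i} = {}" and "\<alpha> \<notin> I"
    using assms by (auto dest: less_asym)
  thus ?thesis unfolding wedge_e wedge_sign_def * by simp
qed


definition is_contraction :: "4 \<Rightarrow> (ext \<Rightarrow> ext) \<Rightarrow> bool" where
  "is_contraction \<alpha> f \<longleftrightarrow>
     Vector_Spaces.linear (*s) (*s) f \<and>
     f (e {}) = 0 \<and>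
     (\<forall>\<beta>. f (e {\<beta>}) = complex_of_real (eta $ \<alpha> $ \<beta>) *s e {}) \<and>
     (\<forall>I J. f (e I \<and>\<^sub>* e J) = f (e I) \<and>\<^sub>* e J + (- 1) ^ card I *s (e I \<and>\<^sub>* f (e J)))"

definition iota :: "4 \<Rightarrow> ext \<Rightarrow> ext" where
  "iota \<alpha> = (THE f. is_contraction \<alpha> f)"

definition gamma_lo :: "4 \<Rightarrow> ext_mat" where
  "gamma_lo \<alpha> = matrix (\<lambda>\<psi>. e {\<alpha>} \<and>\<^sub>* \<psi> - iota \<alpha> \<psi>)"

definition gamma_up :: "4 \<Rightarrow> ext_mat" where
  "gamma_up \<alpha> = (\<Sum>\<beta>\<in>UNIV. (matrix_inv eta $ \<alpha> $ \<beta>) *\<^sub>R gamma_lo \<beta>)"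

definition eta_hat :: ext_mat where
  "eta_hat = (\<chi> I J.
     if card I \<noteq> card J then 0
     else complex_of_real (Determinant.det (Matrix.mat (card I) (card I)
            (\<lambda>(i, j). eta $ (sorted_list_of_set I ! i) $ (sorted_list_of_set J ! j)))))"

definition conj_transpose :: "ext_mat \<Rightarrow> ext_mat" where
  "conj_transpose A = (\<chi> I J. cnj (A $ J $ I))"

definition commutator :: "ext_mat \<Rightarrow> ext_mat \<Rightarrow> ext_mat" where
  "commutator A B = A ** B - B ** A"


definition force_tensor :: "collection \<Rightarrow> bool" where
  "force_tensor \<theta> \<longleftrightarrow>
     (\<forall>\<alpha>. conj_transpose (\<theta> $ \<alpha>) ** eta_hat + eta_hat ** (\<theta> $ \<alpha>) = 0) \<and>
     (\<forall>\<alpha> \<beta>. commutator (gamma_up \<alpha>) (\<theta> $ \<beta>) = 0)"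

definition V_eta :: "collection set" where
  "V_eta = {\<theta>. force_tensor \<theta>}"

definition Theta :: "4 set \<Rightarrow> ext_mat" where
  "Theta I = (THE T. (\<forall>\<alpha>. commutator (gamma_lo \<alpha>) T = 0) \<and> T *v e {} = e I)"

definition Theta_coll :: "4 \<Rightarrow> 4 set \<Rightarrow> collection" where
  "Theta_coll \<beta> I = (\<chi> \<alpha>. if \<alpha> = \<beta> then Theta I else 0)"

(* Collections carry only real scaling as a library operation. *)
definition cscale :: "complex \<Rightarrow> collection \<Rightarrow> collection" where
  "cscale c \<theta> = (\<chi> \<alpha> I J. c * \<theta> $ \<alpha> $ I $ J)"

end

theory Submission
  imports Defs
begin

text \<open>In the basis \<open>e I\<close> the gamma matrices are monomial: \<open>\<gamma>\<^sub>\<alpha> e I\<close> is \<open>clif {\<alpha>} I\<close> times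
  \<open>e (sym_diff {\<alpha>} I)\<close>, where the sign \<open>clif\<close> is bimultiplicative with respect to symmetric
  difference (the Clifford algebra is a twisted group algebra of the group of subsets of \<open>{0,1,2,3}\<close>).
  Bimultiplicativity makes right Clifford multiplications commute with the \<open>\<gamma>\<^sub>\<alpha>\<close>, and as the
  \<open>\<gamma>\<^sub>\<alpha>\<close> generate every \<open>e I\<close> from \<open>e {}\<close>, nothing else does.  For right
  multiplication by \<open>v\<close>, the Hermitian condition decouples into one condition per component,
  \<open>cnj (v J) = - (- 1) ^ (k (k + 1) / 2) v J\<close> with \<open>k = card J\<close>, so \<open>v J\<close> is real for
  \<open>k = 1, 2\<close> and imaginary for \<open>k = 0, 3, 4\<close>.\<close>

text \<open>Each element of \<open>A \<inter> B\<close> occurs in both factors on the right and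
  cancels, since \<open>f x * f x = 1\<close>. Hence products of signs are characters of the group
  of subsets.\<close>

lemma prod_sym_diff:
  fixes f :: "'a \<Rightarrow> 'b::comm_ring_1"
  assumes "finite A" "finite B" and sq: "\<And>x. f x * f x = 1"
  shows "prod f (sym_diff A B) = prod f A * prod f B"
proof -
  have "prod f A = prod f (A - B) * prod f (A \<inter> B)"
    using assms(1) by (metis Diff_Diff_Int Int_lower1 prod.subset_diff Diff_subset mult.commute)
  moreover have "prod f B = prod f (B - A) * prod f (A \<inter> B)"
    using assms(2) by (metis Diff_Diff_Int Int_commute Diff_subset prod.subset_diff mult.commute)
  moreover have "prod f (A \<inter> B) * prod f (A \<inter> B) = 1"
    by (simp add: prod.distrib[symmetric] sq)
  moreover have "prod f (sym_diff A B) = prod f (A - B) * prod f (B - A)"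
    by (rule prod.union_disjoint) (use assms in auto)
  ultimately show ?thesis by (simp add: algebra_simps)
qed

subsection \<open>Signs\<close>

definition eta_diag :: "4 \<Rightarrow> complex" where
  "eta_diag \<alpha> = (if \<alpha> = 0 then 1 else - 1)"

text \<open>A pair in the wrong order costs a transposition; a repeated index gives the square of
  the gamma matrix, which is \<open>- eta_diag i\<close>.\<close>

definition clif_sign :: "4 \<Rightarrow> 4 \<Rightarrow> complex" where
  "clif_sign i j = (if j < i then - 1 else if i = j then - eta_diag i else 1)"

definition clif :: "4 set \<Rightarrow> 4 set \<Rightarrow> complex" where
  "clif I J = (\<Prod>i\<in>I. \<Prod>j\<in>J. clif_sign i j)"

definition eta_prod :: "4 set \<Rightarrow> complex" where
  "eta_prod I = prod eta_diag I"

lemma eta_diag_square [simp]: "eta_diag \<alpha> * eta_diag \<alpha> = 1"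
  by (simp add: eta_diag_def)

lemma clif_sign_square [simp]: "clif_sign i j * clif_sign i j = 1"
  by (simp add: clif_sign_def)

lemma eta_eq: "complex_of_real (eta $ \<alpha> $ \<beta>) = (if \<alpha> = \<beta> then eta_diag \<alpha> else 0)"
  by (simp add: eta_def eta_diag_def)

lemma eta_prod_sym_diff: "eta_prod (sym_diff I J) = eta_prod I * eta_prod J"
  unfolding eta_prod_def by (rule prod_sym_diff) auto

lemma eta_prod_square: "eta_prod I * eta_prod I = 1"
  by (simp add: eta_prod_def prod.distrib[symmetric])

lemma clif_sym_diff_left: "clif (sym_diff I K) J = clif I J * clif K J"
  unfolding clif_def by (rule prod_sym_diff) (auto simp: prod.distrib[symmetric])

lemma clif_sym_diff_right: "clif I (sym_diff J K) = clif I J * clif I K"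
  by (simp add: clif_def prod.distrib[symmetric] prod_sym_diff)

lemma clif_square [simp]: "clif I J * clif I J = 1"
  by (simp add: clif_def prod.distrib[symmetric])

lemma clif_empty [simp]: "clif {} J = 1" "clif I {} = 1"
  by (simp_all add: clif_def)

lemma clif_nonzero [simp]: "clif I J \<noteq> 0"
  using clif_square[of I J] by (metis mult_zero_left zero_neq_one)

text \<open>For \<open>i\<close> different from \<open>\<alpha>\<close>, exactly one of the orders
  \<open>(\<alpha>, i)\<close> and \<open>(i, \<alpha>)\<close> is wrong, so each \<open>i\<close>
  contributes -1. This is anticommutation.\<close>

lemma clif_nonmember:
  assumes "\<alpha> \<notin> I"
  shows "clif {\<alpha>} I * clif I {\<alpha>} = (- 1) ^ card I"
proof -
  have "clif {\<alpha>} I * clif I {\<alpha>} = (\<Prod>i\<in>I. clif_sign \<alpha> i * clif_sign i \<alpha>)"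
    by (simp add: clif_def prod.distrib)
  also have "\<dots> = (\<Prod>i\<in>I. - 1)"
    by (rule prod.cong) (use assms in \<open>auto simp: clif_sign_def\<close>)
  finally show ?thesis by simp
qed

text \<open>Adjoining \<open>x\<close> to \<open>F\<close> contributes -1 from the pair
  \<open>(x, x)\<close> and \<open>(- 1) ^ card F\<close> from the pairs of \<open>x\<close> with
  \<open>F\<close>, so the exponent grows by \<open>card F + 1\<close>.\<close>

lemma clif_self: "clif J J * eta_prod J = (- 1) ^ (\<Sum>i\<le>card J. i)"
proof (induction J rule: finite_induct[OF finite])
  case 1
  show ?case by (simp add: eta_prod_def)
next
  case (2 x F)
  have *: "insert x F = sym_diff {x} F" using 2 by auto
  have "clif {x} {x} * eta_prod {x} = - 1"
    by (simp add: clif_def eta_prod_def clif_sign_def)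
  moreover have "clif (insert x F) (insert x F) * eta_prod (insert x F) =
      (clif {x} {x} * eta_prod {x}) * (clif {x} F * clif F {x}) * (clif F F * eta_prod F)"
    unfolding * clif_sym_diff_left clif_sym_diff_right eta_prod_sym_diff by simp
  ultimately show ?case
    using 2 clif_nonmember[of x F] by (simp add: power_add)
qed

section \<open>Signs of the exterior product and their relation to the Clifford signs\<close>

lemma wedge_sign_prod: "wedge_sign I J = (\<Prod>i\<in>I. \<Prod>j\<in>J. if j < i then - 1 else 1)"
proof -
  have "(\<Prod>i\<in>I. \<Prod>j\<in>J. if j < i then - 1 else 1) =
      (\<Prod>p\<in>I \<times> J. if snd p < fst p then - 1 else (1::complex))"
    by (simp add: prod.cartesian_product split_def)
  also have "\<dots> = (\<Prod>p | p \<in> I \<times> J \<and> snd p < fst p. - 1)"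
    by (simp add: prod.If_cases Int_def)
  also have "{p. p \<in> I \<times> J \<and> snd p < fst p} = {(i, j). i \<in> I \<and> j \<in> J \<and> j < i}" by auto
  finally show ?thesis by (simp add: wedge_sign_def)
qed

lemma wedge_sign_square [simp]: "wedge_sign I J * wedge_sign I J = 1"
  by (simp add: wedge_sign_def power_mult_distrib[symmetric])

lemma wedge_sign_singleton [simp]: "wedge_sign {\<alpha>} {\<alpha>} = 1"
  by (simp add: wedge_sign_prod)

lemma wedge_sign_swap:
  assumes "\<alpha> \<notin> I"
  shows "wedge_sign {\<alpha>} I * wedge_sign I {\<alpha>} = (- 1) ^ card I"
proof -
  have "wedge_sign {\<alpha>} I * wedge_sign I {\<alpha>} =
      (\<Prod>i\<in>I. (if i < \<alpha> then - 1 else 1) * (if \<alpha> < i then - 1 else 1))"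
    by (simp only: wedge_sign_prod prod.distrib) simp
  also have "\<dots> = (\<Prod>i\<in>I. - 1)"
    by (rule prod.cong) (use assms in auto)
  finally show ?thesis by simp
qed

lemma clif_wedge_sign:
  "clif {\<alpha>} I = wedge_sign {\<alpha>} I * (if \<alpha> \<in> I then - eta_diag \<alpha> else 1)"
proof -
  have "clif {\<alpha>} I = (\<Prod>i\<in>I. (if i < \<alpha> then - 1 else 1) * (if i = \<alpha> then - eta_diag \<alpha> else 1))"
    unfolding clif_def by (auto simp: clif_sign_def intro!: prod.cong)
  also have "\<dots> = wedge_sign {\<alpha>} I * (if \<alpha> \<in> I then - eta_diag \<alpha> else 1)"
    by (simp add: prod.distrib wedge_sign_prod prod.delta)
  finally show ?thesis .
qed

subsection \<open>Contractions and gamma matrices\<close>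

lemma wedge_scale: "(c *s u) \<and>\<^sub>* w = c *s (u \<and>\<^sub>* w)" "w \<and>\<^sub>* (c *s u) = c *s (w \<and>\<^sub>* u)"
  using wedge_linear_left[of c u 0 u w] wedge_linear_right[of w c u 0 u] by simp_all

lemma wedge_zero: "0 \<and>\<^sub>* w = 0" "w \<and>\<^sub>* 0 = 0"
  using wedge_scale(1)[of 0 0 w] wedge_scale(2)[of w 0 0] by simp_all

lemma linear_eq_on_e:
  fixes f g :: "ext \<Rightarrow> ext"
  assumes "Vector_Spaces.linear (*s) (*s) f" "Vector_Spaces.linear (*s) (*s) g"
    and "\<And>I. f (e I) = g (e I)"
  shows "f = g"
proof -
  have "matrix f = matrix g"
    using assms(3) by (simp add: matrix_def e_def)
  then show ?thesis
    using matrix_works[OF assms(1)] matrix_works[OF assms(2)] by (metis ext)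
qed

text \<open>An explicit candidate for \<open>iota \<alpha>\<close> in coordinates: only
  \<open>e (insert \<alpha> K)\<close> can contract to a multiple of \<open>e K\<close>.\<close>

definition contr :: "4 \<Rightarrow> ext \<Rightarrow> ext" where
  "contr \<alpha> \<psi> = (\<chi> K. if \<alpha> \<in> K then 0
      else eta_diag \<alpha> * wedge_sign {\<alpha>} K * \<psi> $ insert \<alpha> K)"

lemma linear_contr: "Vector_Spaces.linear (*s) (*s) (contr \<alpha>)"
  by unfold_locales (auto simp: contr_def vec_eq_iff algebra_simps)

lemma wedge_sign_Diff_right:
  "\<alpha> \<in> J \<Longrightarrow> wedge_sign I J = wedge_sign I {\<alpha>} * wedge_sign I (J - {\<alpha>})"
  using wedge_sign_union_right[of "{\<alpha>}" "J - {\<alpha>}" I] by (simp add: insert_absorb)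

lemma wedge_sign_Diff_left:
  "\<alpha> \<in> I \<Longrightarrow> wedge_sign I J = wedge_sign {\<alpha>} J * wedge_sign (I - {\<alpha>}) J"
  using wedge_sign_union_left[of "{\<alpha>}" "I - {\<alpha>}" J] by (simp add: insert_absorb)

lemma contr_e:
  "contr \<alpha> (e I) = (if \<alpha> \<in> I then (eta_diag \<alpha> * wedge_sign {\<alpha>} I) *s e (I - {\<alpha>}) else 0)"
  using wedge_sign_Diff_right[of \<alpha> I "{\<alpha>}"]
  by (auto simp: contr_def e_def axis_def vec_eq_iff insert_absorb)

text \<open>If \<open>I\<close> and \<open>J\<close> are disjoint, at most one term on the right
  survives. If they share only \<open>\<alpha>\<close>, the left side is 0 and the two terms cancel.
  If they share another index, everything vanishes.\<close>

lemma contr_wedge: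
  "contr \<alpha> (e I \<and>\<^sub>* e J) = contr \<alpha> (e I) \<and>\<^sub>* e J + (- 1) ^ card I *s (e I \<and>\<^sub>* contr \<alpha> (e J))"
proof -
  interpret Vector_Spaces.linear "(*s)" "(*s)" "contr \<alpha>" by (rule linear_contr)
  show ?thesis
  proof (cases "I \<inter> J = {}")
    case disj: True
    consider "\<alpha> \<in> I" "\<alpha> \<notin> J" | "\<alpha> \<notin> I" "\<alpha> \<in> J" | "\<alpha> \<notin> I" "\<alpha> \<notin> J"
      using disj by auto
    then show ?thesis
    proof cases
      case 1
      then have "I \<union> J - {\<alpha>} = (I - {\<alpha>}) \<union> J" "(I - {\<alpha>}) \<inter> J = {}" using disj by auto
      with 1 disj show ?thesis
        using wedge_sign_Diff_left[of \<alpha> I J]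
        by (simp add: wedge_e scale contr_e wedge_scale wedge_zero wedge_sign_union_right
            vector_smult_assoc)
    next
      case 2
      then have "I \<union> J - {\<alpha>} = I \<union> (J - {\<alpha>})" "I \<inter> (J - {\<alpha>}) = {}" using disj by auto
      with 2 disj show ?thesis
        \<comment> \<open>Extracting \<open>\<alpha>\<close> from the second factor moves it past
          all of \<open>I\<close>, which produces \<open>(- 1) ^ card I\<close>.\<close>
        using wedge_sign_Diff_right[of \<alpha> J I] wedge_sign_swap[of \<alpha> I, symmetric]
        by (simp add: wedge_e scale contr_e wedge_scale wedge_zero wedge_sign_union_right
            vector_smult_assoc mult_ac)
    next
      case 3
      with disj show ?thesis by (simp add: wedge_e scale contr_e wedge_zero)
    qed
  next
    case False
    show ?thesis
    proof (cases "I \<inter> J = {\<alpha>}")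
      case True
      then have mem: "\<alpha> \<in> I" "\<alpha> \<in> J" by auto
      have sets: "(I - {\<alpha>}) \<union> J = I \<union> (J - {\<alpha>})" "(I - {\<alpha>}) \<inter> J = {}" "I \<inter> (J - {\<alpha>}) = {}"
        using True by auto
      have card: "card I = Suc (card (I - {\<alpha>}))"
        using mem by (metis card_Suc_Diff1 finite)
      define s where "s = wedge_sign (I - {\<alpha>}) (J - {\<alpha>})"
      have "wedge_sign {\<alpha>} I = wedge_sign {\<alpha>} (I - {\<alpha>})"
        "wedge_sign (I - {\<alpha>}) J = wedge_sign (I - {\<alpha>}) {\<alpha>} * s"
        "wedge_sign {\<alpha>} J = wedge_sign {\<alpha>} (J - {\<alpha>})"
        "wedge_sign I (J - {\<alpha>}) = wedge_sign {\<alpha>} (J - {\<alpha>}) * s"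
        using wedge_sign_Diff_right[OF mem(1), of "{\<alpha>}"] wedge_sign_Diff_right[OF mem(2), of "{\<alpha>}"]
          wedge_sign_Diff_right[OF mem(2), of "I - {\<alpha>}"] wedge_sign_Diff_left[OF mem(1), of "J - {\<alpha>}"]
        by (simp_all add: s_def)
      note signs = this
      \<comment> \<open>Here \<open>\<alpha>\<close> passes only \<open>card I - 1\<close> indices;
        the missing one is the minus sign behind the cancellation.\<close>
      have "wedge_sign {\<alpha>} I * wedge_sign (I - {\<alpha>}) J = - ((- 1) ^ card I * s)"
        using wedge_sign_swap[of \<alpha> "I - {\<alpha>}"] by (simp add: signs card mult.assoc[symmetric])
      moreover have "wedge_sign {\<alpha>} J * wedge_sign I (J - {\<alpha>}) = s"
        by (simp add: signs mult.assoc[symmetric])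
      ultimately show ?thesis
        using mem False sets
        by (simp add: wedge_e contr_e wedge_scale vector_smult_assoc mult.assoc
            vector_sadd_rdistrib[symmetric])
    next
      case no: False
      then have "(I - {\<alpha>}) \<inter> J \<noteq> {}" "I \<inter> (J - {\<alpha>}) \<noteq> {}" using False by auto
      with False show ?thesis by (simp add: wedge_e contr_e wedge_scale wedge_zero)
    qed
  qed
qed

lemma is_contraction_contr: "is_contraction \<alpha> (contr \<alpha>)"
  unfolding is_contraction_def
  using linear_contr contr_wedge by (auto simp: contr_e eta_eq)

text \<open>Up to sign, every \<open>e I\<close> is an iterated exterior product of basis vectors,
  so the product rule fixes the values by induction on \<open>I\<close>.\<close>

lemma is_contraction_unique:
  assumes f: "is_contraction \<alpha> f" and g: "is_contraction \<alpha> g"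
  shows "f = g"
proof (rule linear_eq_on_e)
  show lf: "Vector_Spaces.linear (*s) (*s) f" and lg: "Vector_Spaces.linear (*s) (*s) g"
    using f g by (auto simp: is_contraction_def)
  interpret f: Vector_Spaces.linear "(*s)" "(*s)" f by (rule lf)
  interpret g: Vector_Spaces.linear "(*s)" "(*s)" g by (rule lg)
  fix I
  show "f (e I) = g (e I)"
  proof (induction I rule: finite_induct[OF finite])
    case 1
    show ?case using f g by (simp add: is_contraction_def)
  next
    case (2 x F)
    \<comment> \<open>The induction adds \<open>x\<close> in arbitrary order, so a sorting sign
      appears.\<close>
    have "e (insert x F) = wedge_sign {x} F *s (e {x} \<and>\<^sub>* e F)"
      using 2 by (simp add: wedge_e vector_smult_assoc)
    moreover have "f (e {x} \<and>\<^sub>* e F) = g (e {x} \<and>\<^sub>* e F)"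
      using f g 2 by (simp add: is_contraction_def)
    ultimately show ?case by (simp add: f.scale g.scale)
  qed
qed

lemma iota_eq_contr: "iota \<alpha> = contr \<alpha>"
  unfolding iota_def using is_contraction_contr is_contraction_unique by blast

text \<open>Only the exterior part acts if \<open>\<alpha>\<close> is not in \<open>I\<close>, only
  the contraction if it is; symmetric difference covers both cases.\<close>

lemma gamma_lo_entry:
  "gamma_lo \<alpha> $ K $ I = (if K = sym_diff {\<alpha>} I then clif {\<alpha>} I else 0)"
proof -
  have "gamma_lo \<alpha> $ K $ I = (e {\<alpha>} \<and>\<^sub>* e I - contr \<alpha> (e I)) $ K"
    by (simp add: gamma_lo_def matrix_def e_def iota_eq_contr)
  moreover have "sym_diff {\<alpha>} I = (if \<alpha> \<in> I then I - {\<alpha>} else insert \<alpha> I)" by auto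
  moreover have "e J $ K = (if K = J then 1 else 0)" for J
    by (simp add: e_def axis_def eq_commute)
  ultimately show ?thesis
    by (cases "\<alpha> \<in> I") (simp_all add: wedge_e contr_e clif_wedge_sign mult.commute)
qed

lemma gamma_up_eq: "gamma_up \<alpha> = eta $ \<alpha> $ \<alpha> *\<^sub>R gamma_lo \<alpha>"
proof -
  have "eta ** eta = mat 1"
    by (auto simp: matrix_matrix_mult_def eta_def mat_def vec_eq_iff if_distrib[of "\<lambda>x. x * _"]
        cong: if_cong)
  \<comment> \<open>\<open>matrix_inv\<close> chooses some two-sided inverse, so uniqueness of
    inverses is needed as well.\<close>
  then have "matrix_inv eta = eta"
    unfolding matrix_inv_def
    by (intro some_equality) (auto, metis matrix_mul_assoc matrix_mul_lid matrix_mul_rid)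
  then have "gamma_up \<alpha> = (\<Sum>\<beta>\<in>UNIV. if \<beta> = \<alpha> then eta $ \<alpha> $ \<alpha> *\<^sub>R gamma_lo \<alpha> else 0)"
    unfolding gamma_up_def by (intro sum.cong) (auto simp: eta_def)
  then show ?thesis by simp
qed

lemma commutator_gamma_up_eq_0_iff:
  "commutator (gamma_up \<alpha>) T = 0 \<longleftrightarrow> commutator (gamma_lo \<alpha>) T = 0"
proof -
  have "commutator (gamma_up \<alpha>) T = eta $ \<alpha> $ \<alpha> *\<^sub>R commutator (gamma_lo \<alpha>) T"
    by (simp add: commutator_def gamma_up_eq scalar_matrix_assoc[symmetric]
        matrix_scalar_ac scaleR_diff_right)
  then show ?thesis by (simp add: eta_def)
qed

subsection \<open>The commutant of the gamma matrices\<close>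

text \<open>The matrix of right Clifford multiplication by \<open>v\<close>.\<close>
definition rmul :: "ext \<Rightarrow> ext_mat" where
  "rmul v = (\<chi> K I. v $ sym_diff I K * clif I (sym_diff I K))"

lemma gamma_lo_mult_entry:
  "(gamma_lo \<alpha> ** T) $ K $ I = clif {\<alpha>} (sym_diff {\<alpha>} K) * T $ sym_diff {\<alpha>} K $ I"
proof -
  define S where "S = sym_diff {\<alpha>} K"
  have "K = sym_diff {\<alpha>} L \<longleftrightarrow> L = S" for L
    unfolding S_def by blast
  then have "gamma_lo \<alpha> $ K $ L * T $ L $ I = (if L = S then clif {\<alpha>} L * T $ L $ I else 0)" for L
    unfolding gamma_lo_entry by simp
  then show ?thesis
    by (simp add: matrix_matrix_mult_def S_def[symmetric])
qed

lemma mult_gamma_lo_entry: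
  "(T ** gamma_lo \<alpha>) $ K $ I = T $ K $ sym_diff {\<alpha>} I * clif {\<alpha>} I"
proof -
  define S where "S = sym_diff {\<alpha>} I"
  have "T $ K $ L * gamma_lo \<alpha> $ L $ I = (if L = S then T $ K $ L * clif {\<alpha>} I else 0)" for L
    unfolding gamma_lo_entry S_def[symmetric] by simp
  then show ?thesis
    by (simp add: matrix_matrix_mult_def S_def[symmetric])
qed

text \<open>Left and right Clifford multiplications commute by associativity. In signs, both sides
  expand to \<open>clif {\<alpha>} M * clif {\<alpha>} I * clif I M\<close>.\<close>

lemma commutator_rmul: "commutator (gamma_lo \<alpha>) (rmul v) = 0"
proof -
  have "(gamma_lo \<alpha> ** rmul v) $ K $ I = (rmul v ** gamma_lo \<alpha>) $ K $ I" for K I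
  proof -
    \<comment> \<open>The index of the only component of \<open>v\<close> that enters this entry, on
      either side.\<close>
    define M where "M = sym_diff (sym_diff {\<alpha>} I) K"
    have M: "sym_diff I (sym_diff {\<alpha>} K) = M" "sym_diff {\<alpha>} K = sym_diff M I"
      unfolding M_def by blast+
    have "(gamma_lo \<alpha> ** rmul v) $ K $ I = clif {\<alpha>} (sym_diff {\<alpha>} K) * (v $ M * clif I M)"
      unfolding gamma_lo_mult_entry rmul_def vec_lambda_beta M(1) ..
    also have "\<dots> = v $ M * clif (sym_diff {\<alpha>} I) M * clif {\<alpha>} I"
      unfolding M(2) clif_sym_diff_left clif_sym_diff_right by simp
    also have "\<dots> = (rmul v ** gamma_lo \<alpha>) $ K $ I"
      unfolding mult_gamma_lo_entry rmul_def vec_lambda_beta M_def ..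
    finally show ?thesis .
  qed
  then show ?thesis by (simp add: commutator_def vec_eq_iff)
qed

lemma matrix_vector_e: "(T *v e I) $ K = T $ K $ I" for T :: ext_mat
  by (simp add: e_def matrix_vector_mul_component inner_vec_def matrix_vector_mult_def axis_def
      if_distrib[of "\<lambda>x. _ * x"] cong: if_cong)

lemma rmul_e_empty: "rmul v *v e {} = v"
  by (simp add: vec_eq_iff matrix_vector_e rmul_def)

text \<open>The vector \<open>e {}\<close> is cyclic: gamma matrices produce every
  \<open>e I\<close> from it up to a nonzero factor, and commuting operators carry the agreement
  along.\<close>

lemma commutant_unique:
  assumes S: "\<And>\<alpha>. commutator (gamma_lo \<alpha>) S = 0" and T: "\<And>\<alpha>. commutator (gamma_lo \<alpha>) T = 0"
    and eq: "S *v e {} = T *v e {}"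
  shows "S = T"
proof -
  have on_e: "S *v e I = T *v e I" for I
  proof (induction I rule: finite_induct[OF finite])
    case 1
    show ?case by (rule eq)
  next
    case (2 x F)
    have "insert x F = sym_diff {x} F" using 2 by auto
    then have g: "gamma_lo x *v e F = clif {x} F *s e (insert x F)"
      by (simp add: vec_eq_iff matrix_vector_e gamma_lo_entry) (simp add: e_def axis_def)
    have step: "clif {x} F *s (U *v e (insert x F)) = gamma_lo x *v (U *v e F)"
      if "commutator (gamma_lo x) U = 0" for U
    proof -
      have "clif {x} F *s (U *v e (insert x F)) = U *v (gamma_lo x *v e F)"
        by (simp only: g vector_scalar_commute)
      also have "\<dots> = gamma_lo x *v (U *v e F)"
        using that by (simp add: commutator_def matrix_vector_mul_assoc)
      finally show ?thesis .
    qed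
    have "clif {x} F *s (S *v e (insert x F)) = clif {x} F *s (T *v e (insert x F))"
      by (simp add: step S T 2)
    then show ?case by (simp add: vec_eq_iff)
  qed
  show ?thesis
    unfolding vec_eq_iff by (simp only: matrix_vector_e[symmetric] on_e simp_thms)
qed

lemma commutant_eq_rmul:
  "(\<forall>\<alpha>. commutator (gamma_lo \<alpha>) T = 0) \<longleftrightarrow> (\<exists>v. T = rmul v)"
  using commutant_unique[of T "rmul (T *v e {})"] commutator_rmul rmul_e_empty by metis

lemma Theta_eq: "Theta I = rmul (e I)"
  unfolding Theta_def
  by (rule the_equality) (auto simp: commutator_rmul rmul_e_empty intro: commutant_unique)

subsection \<open>The Hermitian condition\<close>

text \<open>As \<open>eta\<close> is diagonal, the submatrix for \<open>I = J\<close> is diagonal.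
  For distinct sets of equal size, an index in \<open>I\<close> outside \<open>J\<close> gives a
  zero row.\<close>

lemma eta_hat_entry: "eta_hat $ I $ J = (if I = J then eta_prod I else 0)"
proof (cases "card I = card J")
  case True
  let ?l = sorted_list_of_set
  let ?A = "Matrix.mat (card I) (card I) (\<lambda>(i, j). eta $ (?l I ! i) $ (?l J ! j))"
  have ent: "eta_hat $ I $ J = complex_of_real (Determinant.det ?A)"
    using True by (simp add: eta_hat_def)
  show ?thesis
  proof (cases "I = J")
    case IJ: True
    have inj: "?l J ! i = ?l J ! j \<longleftrightarrow> i = j" if "i < card J" "j < card J" for i j
      using that by (simp add: nth_eq_iff_index_eq)
    have "Determinant.det ?A = prod_list (diag_mat ?A)"
      by (rule det_upper_triangular[of _ "card I"])
        (use IJ inj in \<open>auto simp: upper_triangular_def eta_def\<close>)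
    also have "\<dots> = (\<Prod>i<card I. eta $ (?l I ! i) $ (?l I ! i))"
      using IJ by (simp add: diag_mat_def prod.list_conv_set_nth atLeast0LessThan)
    also have "\<dots> = (\<Prod>i\<in>I. eta $ i $ i)"
      by (rule prod.reindex_bij_betw) (simp add: bij_betw_nth)
    finally show ?thesis
      using IJ ent by (simp add: eta_prod_def eta_eq)
  next
    case False
    then obtain a where a: "a \<in> I" "a \<notin> J"
      using True by (metis card_subset_eq finite subsetI)
    then obtain i where i: "i < card I" "?l I ! i = a"
      by (metis finite in_set_conv_nth length_sorted_list_of_set set_sorted_list_of_set)
    have "?l J ! j \<noteq> a" if "j < card I" for j
      using that True a(2) by (metis finite nth_mem length_sorted_list_of_set set_sorted_list_of_set)
    then have "eta $ (?l I ! i) $ (?l J ! j) = 0" if "j < card I" for j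
      using that i(2) by (metis eta_eq of_real_eq_0_iff)
    then have zero: "?A $$ (i, j) = 0" if "j < card I" for j
      using that i(1) by simp
    \<comment> \<open>Every term of the Leibniz expansion contains an entry of the zero row
      \<open>i\<close>.\<close>
    have "(\<Prod>k = 0..<card I. ?A $$ (k, p k)) = 0" if "p permutes {0..<card I}" for p
    proof (rule prod_zero)
      have "p i < card I"
        using permutes_in_image[OF that, of i] i(1) by simp
      then show "\<exists>k\<in>{0..<card I}. ?A $$ (k, p k) = 0"
        using zero i(1) by (metis atLeastLessThan_iff le0)
    qed simp
    then have "Determinant.det ?A = 0"
      by (subst Determinant.det_def'[of _ "card I"]) (auto simp del: index_mat prod_zero_iff)
    with ent False show ?thesis by simp
  qed
qed (auto simp: eta_hat_def)

lemma eta_hat_antihermitian_entry: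
  "(conj_transpose T ** eta_hat + eta_hat ** T) $ I $ K =
     cnj (T $ K $ I) * eta_prod K + eta_prod I * T $ I $ K"
  by (simp add: matrix_matrix_mult_def eta_hat_entry conj_transpose_def if_distrib[of "\<lambda>x. x * _"]
      if_distrib[of "\<lambda>x. _ * x"] cong: if_cong)

text \<open>The entry at \<open>(I, K)\<close> sees only the component \<open>v $ J\<close> with
  \<open>J = sym_diff I K\<close>, and up to a nonzero sign it depends on \<open>J\<close>
  alone.\<close>

lemma antihermitian_rmul_iff:
  "conj_transpose (rmul v) ** eta_hat + eta_hat ** rmul v = 0 \<longleftrightarrow>
     (\<forall>J. cnj (v $ J) + (- 1) ^ (\<Sum>i\<le>card J. i) * v $ J = 0)"
proof -
  have cnj_clif: "cnj (clif I J) = clif I J" for I J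
    by (simp add: clif_def clif_sign_def eta_diag_def if_distrib[of cnj] cong: if_cong)
  have entry: "(conj_transpose (rmul v) ** eta_hat + eta_hat ** rmul v) $ I $ K =
      eta_prod I * eta_prod J * clif I J * (cnj (v $ J) + (- 1) ^ (\<Sum>i\<le>card J. i) * v $ J)"
    if J: "J = sym_diff I K" for I J K
  proof -
    have K: "K = sym_diff I J" and KI: "sym_diff K I = J" using J by auto
    have "(conj_transpose (rmul v) ** eta_hat + eta_hat ** rmul v) $ I $ K =
        cnj (v $ J) * clif I J * eta_prod K + eta_prod I * (v $ J * clif K J)"
      unfolding eta_hat_antihermitian_entry using J KI by (simp add: rmul_def cnj_clif)
    also have "\<dots> = eta_prod I * clif I J * (eta_prod J * cnj (v $ J) + clif J J * v $ J)"
      unfolding K eta_prod_sym_diff clif_sym_diff_left by (simp add: algebra_simps)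
    also have "clif J J = eta_prod J * (- 1) ^ (\<Sum>i\<le>card J. i)"
      using eta_prod_square[of J] by (simp add: clif_self[symmetric])
    finally show ?thesis by (simp add: algebra_simps)
  qed
  have nz: "eta_prod I \<noteq> 0" for I using eta_prod_square[of I] by auto
  show ?thesis
  proof
    assume *: "conj_transpose (rmul v) ** eta_hat + eta_hat ** rmul v = 0"
    show "\<forall>J. cnj (v $ J) + (- 1) ^ (\<Sum>i\<le>card J. i) * v $ J = 0"
    proof
      fix J
      show "cnj (v $ J) + (- 1) ^ (\<Sum>i\<le>card J. i) * v $ J = 0"
        \<comment> \<open>Row \<open>{}\<close> and column \<open>J\<close> already give the
          condition on \<open>v $ J\<close>.\<close>
        using entry[of J "{}" J] nz unfolding * by simp
    qed
  next
    assume "\<forall>J. cnj (v $ J) + (- 1) ^ (\<Sum>i\<le>card J. i) * v $ J = 0"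
    then show "conj_transpose (rmul v) ** eta_hat + eta_hat ** rmul v = 0"
      unfolding vec_eq_iff using entry by simp
  qed
qed

text \<open>A generator of the real line of solutions of the Hermitian condition in component
  \<open>J\<close>.\<close>

definition phase :: "4 set \<Rightarrow> complex" where
  "phase J = (if card J \<in> {1, 2} then 1 else \<i>)"

lemma phase_nonzero: "phase J \<noteq> 0"
  by (simp add: phase_def)

text \<open>For sizes 0 to 4 the exponent is 0, 1, 3, 6, 10. It is odd exactly for sizes 1 and 2,
  where \<open>z\<close> must be real; otherwise \<open>z\<close> must be imaginary.\<close>

lemma cnj_condition_iff:
  "cnj z + (- 1) ^ (\<Sum>i\<le>card J. i) * z = 0 \<longleftrightarrow> (\<exists>x. z = complex_of_real x * phase J)"
proof -
  have "card J \<le> 4"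
    using card_mono[of UNIV J] by simp
  then consider "card J = 0" | "card J = 1" | "card J = 2" | "card J = 3" | "card J = 4" by linarith
  then show ?thesis
    by cases (auto simp only: phase_def, auto simp: complex_eq_iff eval_nat_numeral)
qed

subsection \<open>A linear parametrisation of the force tensors\<close>

text \<open>The domain is a Euclidean space of dimension \<open>4 * 2 ^ 4\<close>, so the basis and
  dimension of \<open>V_eta\<close> can be transported from it.\<close>

definition param :: "real ^ (4 \<times> 4 set) \<Rightarrow> collection" where
  "param x = (\<chi> \<beta>. rmul (\<chi> J. complex_of_real (x $ (\<beta>, J)) * phase J))"

lemma V_eta_eq: "V_eta = range param"
proof -
  have "force_tensor \<theta> \<longleftrightarrow> (\<exists>x. \<theta> = param x)" for \<theta>
  proof -
    have "force_tensor \<theta> \<longleftrightarrow> (\<forall>\<beta>. \<exists>v. \<theta> $ \<beta> = rmul v \<and>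
        (\<forall>J. \<exists>x. v $ J = complex_of_real x * phase J))"
      unfolding force_tensor_def commutator_gamma_up_eq_0_iff cnj_condition_iff[symmetric]
      using commutant_eq_rmul antihermitian_rmul_iff by metis
    also have "\<dots> \<longleftrightarrow> (\<exists>x. \<theta> = param x)"
    proof
      assume "\<forall>\<beta>. \<exists>v. \<theta> $ \<beta> = rmul v \<and> (\<forall>J. \<exists>x. v $ J = complex_of_real x * phase J)"
      then obtain v x where vx: "\<And>\<beta>. \<theta> $ \<beta> = rmul (v \<beta>)"
        "\<And>\<beta> J. v \<beta> $ J = complex_of_real (x \<beta> J) * phase J"
        by metis
      have "\<theta> = param (\<chi> p. x (fst p) (snd p))"
        by (simp add: param_def vec_eq_iff vx rmul_def)
      then show "\<exists>x. \<theta> = param x" ..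
    qed (auto simp: param_def)
    finally show ?thesis .
  qed
  then show ?thesis by (auto simp: V_eta_def)
qed

lemma linear_param: "linear param"
  by (rule linearI)
    (simp_all add: param_def rmul_def vec_eq_iff algebra_simps scaleR_conv_of_real[where 'a=complex])

lemma inj_param: "inj param"
proof (rule injI)
  fix x y assume "param x = param y"
  \<comment> \<open>Column \<open>{}\<close> of \<open>rmul v\<close> is \<open>v\<close> itself,
    which exposes the coordinates.\<close>
  then have "param x $ \<beta> $ J $ {} = param y $ \<beta> $ J $ {}" for \<beta> J by simp
  then have "x $ (\<beta>, J) = y $ (\<beta>, J)" for \<beta> J
    by (simp add: param_def rmul_def phase_nonzero)
  then show "x = y" by (auto simp: vec_eq_iff)
qed

lemma param_axis: "param (axis (\<beta>, J) 1) = cscale (phase J) (Theta_coll \<beta> J)"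
  by (auto simp: param_def cscale_def Theta_coll_def Theta_eq rmul_def vec_eq_iff e_def axis_def)

lemma sets_by_card:
  "{{0}, {1}, {2}, {3}, {0,1}, {0,2}, {0,3}, {1,2}, {1,3}, {2,3}} = {I :: 4 set. card I \<in> {1, 2}}"
    (is "?R = _")
  "{{}, {0,1,2}, {0,1,3}, {0,2,3}, {1,2,3}, {0,1,2,3}} = {I :: 4 set. card I \<notin> {1, 2}}"
    (is "?C = _")
proof -
  have U: "(UNIV :: 4 set) = {0, 1, 2, 3}"
  proof -
    \<comment> \<open>Arithmetic in the index type is modulo 4.\<close>
    have four: "(4 :: 4) = 0" by simp
    show ?thesis unfolding UNIV_4 four by (simp only: insert_commute)
  qed
  have "(UNIV :: 4 set set) = Pow {0, 1, 2, 3}"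
    by (rule Pow_UNIV[where 'a=4, symmetric, unfolded U])
  also have "\<dots> \<subseteq> ?R \<union> ?C"
    by (simp only: Pow_insert Pow_empty image_insert image_empty image_Un Un_subset_iff
        insert_subset empty_subsetI simp_thms)
      (simp only: Un_insert_left Un_insert_right insert_iff Un_empty_left simp_thms)
  finally have all: "UNIV \<subseteq> ?R \<union> ?C" .
  have R: "\<forall>I\<in>?R. card I \<in> {1, 2}" and C: "\<forall>I\<in>?C. card I \<notin> {1, 2}" by simp_all
  \<comment> \<open>Two sets that cover everything and lie on opposite sides of \<open>P\<close> are
    exactly the two sides.\<close>
  have split: "A = {I. P I} \<and> B = {I. \<not> P I}"
    if "UNIV \<subseteq> A \<union> B" "\<forall>I\<in>A. P I" "\<forall>I\<in>B. \<not> P I" for A B :: "4 set set" and P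
    using that by blast
  show "?R = {I. card I \<in> {1, 2}}"
    using split[OF all R C] by (rule conjunct1)
  show "?C = {I. card I \<notin> {1, 2}}"
    using split[OF all R C] by (rule conjunct2)
qed

theorem mainTheorem1:
  fixes B :: "collection set"
  assumes B_def: "B =
     {Theta_coll \<beta> I | \<beta> I. I \<in> {{0}, {1}, {2}, {3}, {0,1}, {0,2}, {0,3}, {1,2}, {1,3}, {2,3}}} \<union>
     {cscale \<i> (Theta_coll \<beta> J) | \<beta> J. J \<in> {{}, {0,1,2}, {0,1,3}, {0,2,3}, {1,2,3}, {0,1,2,3}}}"
  shows "subspace V_eta \<and> independent B \<and> span B = V_eta \<and> dim V_eta = 64"
proof -
  have cscale_1: "cscale 1 \<theta> = \<theta>" for \<theta>
    by (simp add: cscale_def vec_eq_iff)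
  have "B = {cscale (phase J) (Theta_coll \<beta> J) | \<beta> J. True}"
    unfolding B_def sets_by_card mem_Collect_eq phase_def by (auto simp: cscale_1)
  \<comment> \<open>The standard basis consists of the vectors \<open>axis (\<beta>, J) 1\<close>,
    whose images are given by \<open>param_axis\<close>.\<close>
  also have "\<dots> = param ` Basis"
    by (auto simp: Basis_vec_def param_axis[symmetric])
  finally have B: "B = param ` Basis" .
  have "subspace V_eta"
    unfolding V_eta_eq by (rule linear_subspace_image[OF linear_param subspace_UNIV])
  moreover have "independent B"
    unfolding B by (rule linear_independent_injective_image[OF linear_param independent_Basis])
      (simp add: inj_param)
  moreover have "span B = V_eta"
    unfolding B V_eta_eq by (simp add: linear_span_image[OF linear_param])
  moreover have "dim V_eta = 64"
    unfolding V_eta_eq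
    by (simp add: dim_image_eq[OF linear_param] inj_param card_UNIV_set)
  ultimately show ?thesis by blast
qed

end
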